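(* Let $\mathscr{C}$ and $\mathscr{D}$ be monoidal categories with units $I$ and $J$ respectively, let $(F,\phi_2):\mathscr{C}\to\mathscr{D}$ be a strong multiplicative functor, and let $\phi_0: J\to F(I)$ be an isomorphism in $\mathscr{D}$. Then $\phi_0$ is an LR-unit compatibility for $F$ if and only if it is a Saavedra-unit compatibility for $F$.
   Context: A semi-monoidal category is a category $\mathscr{C}$ with a strictly associative functor $\mathscr{C}\times\mathscr{C}\to\mathscr{C}$, written as juxtaposition. The identity arrow of an object $X$ is also written $X$. An LR unit is a triple $(I,\lambda,\rho)$ with $\lambda_X: IX\to X$, $\rho_X: XI\to X$ natural isomorphisms satisfying, for all $X,Y$: $\lambda_I=\rho_I$; $\lambda_{XY}=\lambda_X Y$; $\rho_{XY}=X\rho_Y$; $X\lambda_Y=\rho_X Y$. A Saavedra unit is a pair $(I,\alpha)$ where $\alpha:II\to I$ is an isomorphism and $I$ is cancellable, meaning that the functors $X\mapsto IX$ and $X\mapsto XI$ are fully faithful. The two structures on an object $I$ correspond bijectively via $\alpha=\lambda_I=\rho_I$, respectively $I\lambda_X=\alpha X$ and $\rho_XI=X\alpha$. A monoidal category is a semi-monoidal category with a unit, carrying both corresponding structures: $(I,\lambda^I,\rho^I)$ and $(I,\alpha)$ for $\mathscr{C}$, and $(J,\lambda^J,\rho^J)$ and $(J,\beta)$ for $\mathscr{D}$. A strong multiplicative functor $(F,\phi_2)$ is a functor $F$ with natural isomorphisms $\phi_{X,Y}:F(X)F(Y)\to F(XY)$ (collectively $\phi_2$) such that $\phi_{XY,Z}\circ(\phi_{X,Y}F(Z))=\phi_{X,YZ}\circ(F(X)\phi_{Y,Z})$.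 An isomorphism $\phi_0:J\to F(I)$ is an LR-unit compatibility if for every object $X$ of $\mathscr{C}$ $$\lambda^J_{F(X)}=F(\lambda^I_X)\circ\phi_{I,X}\circ(\phi_0F(X)),\qquad \rho^J_{F(X)}=F(\rho^I_X)\circ\phi_{X,I}\circ(F(X)\phi_0).$$ It is a Saavedra-unit compatibility if it is a semi-monoid homomorphism, i.e. $\phi_0\circ\beta=F(\alpha)\circ\phi_{I,I}\circ(\phi_0\phi_0)$ as arrows $JJ\to F(I)$. *)

theory Defs
  imports Main
begin

section \<open>Categories, functors, natural isomorphisms\<close>

text \<open>
  A category is given by a set of objects and a set of arrows inside ambient types;
  \<open>dom\<close>, \<open>cod\<close>, \<open>idt\<close> and composition are constrained only on these sets. Composition
  is written in the usual order: \<open>g \<cdot> f\<close> is \<open>f\<close> followed by \<open>g\<close>.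
\<close>

record ('o, 'a) category =
  Obj :: "'o set"
  Arr :: "'a set"
  dom :: "'a \<Rightarrow> 'o"
  cod :: "'a \<Rightarrow> 'o"
  idt :: "'o \<Rightarrow> 'a"
  comp :: "'a \<Rightarrow> 'a \<Rightarrow> 'a"  (infixr "\<cdot>\<index>" 60)

definition hom :: "('o, 'a, 'm) category_scheme \<Rightarrow> 'o \<Rightarrow> 'o \<Rightarrow> 'a set" where
  "hom C X Y = {f \<in> Arr C. dom C f = X \<and> cod C f = Y}"

locale category =
  fixes C :: "('o, 'a, 'm) category_scheme" (structure)
  assumes dom_obj: "f \<in> Arr C \<Longrightarrow> dom C f \<in> Obj C"
    and cod_obj: "f \<in> Arr C \<Longrightarrow> cod C f \<in> Obj C"
    and idt_hom: "X \<in> Obj C \<Longrightarrow> idt C X \<in> hom C X X"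
    and comp_hom: "\<lbrakk>f \<in> hom C X Y; g \<in> hom C Y Z\<rbrakk> \<Longrightarrow> g \<cdot> f \<in> hom C X Z"
    and comp_idt: "f \<in> hom C X Y \<Longrightarrow> f \<cdot> idt C X = f"
    and idt_comp: "f \<in> hom C X Y \<Longrightarrow> idt C Y \<cdot> f = f"
    and comp_assoc: "\<lbrakk>f \<in> hom C W X; g \<in> hom C X Y; h \<in> hom C Y Z\<rbrakk>
          \<Longrightarrow> (h \<cdot> g) \<cdot> f = h \<cdot> (g \<cdot> f)"

definition is_iso :: "('o, 'a, 'm) category_scheme \<Rightarrow> 'o \<Rightarrow> 'o \<Rightarrow> 'a \<Rightarrow> bool" where
  "is_iso C X Y f \<longleftrightarrow> f \<in> hom C X Y \<and>
     (\<exists>g \<in> hom C Y X. g \<cdot>\<^bsub>C\<^esub> f = idt C X \<and> f \<cdot>\<^bsub>C\<^esub> g = idt C Y)"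

definition prod_cat ::
    "('o, 'a, 'm) category_scheme \<Rightarrow> ('p, 'b, 'n) category_scheme \<Rightarrow> ('o \<times> 'p, 'a \<times> 'b) category" where
  "prod_cat C D = \<lparr>Obj = Obj C \<times> Obj D, Arr = Arr C \<times> Arr D,
     dom = map_prod (dom C) (dom D), cod = map_prod (cod C) (cod D),
     idt = map_prod (idt C) (idt D),
     comp = (\<lambda>(g, g') (f, f'). (g \<cdot>\<^bsub>C\<^esub> f, g' \<cdot>\<^bsub>D\<^esub> f'))\<rparr>"

record ('o, 'a, 'p, 'b) fctr =
  fobj :: "'o \<Rightarrow> 'p"
  farr :: "'a \<Rightarrow> 'b"

definition is_functor ::
    "('o, 'a, 'm) category_scheme \<Rightarrow> ('p, 'b, 'n) category_scheme \<Rightarrow> ('o, 'a, 'p, 'b) fctr \<Rightarrow> bool" where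
  "is_functor C D F \<longleftrightarrow>
     (\<forall>X \<in> Obj C. fobj F X \<in> Obj D) \<and>
     (\<forall>X \<in> Obj C. \<forall>Y \<in> Obj C. \<forall>f \<in> hom C X Y. farr F f \<in> hom D (fobj F X) (fobj F Y)) \<and>
     (\<forall>X \<in> Obj C. farr F (idt C X) = idt D (fobj F X)) \<and>
     (\<forall>f \<in> Arr C. \<forall>g \<in> Arr C. cod C f = dom C g \<longrightarrow>
        farr F (g \<cdot>\<^bsub>C\<^esub> f) = farr F g \<cdot>\<^bsub>D\<^esub> farr F f)"

definition fully_faithful ::
    "('o, 'a, 'm) category_scheme \<Rightarrow> ('p, 'b, 'n) category_scheme \<Rightarrow> ('o, 'a, 'p, 'b) fctr \<Rightarrow> bool" where
  "fully_faithful C D F \<longleftrightarrow> is_functor C D F \<and>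
     (\<forall>X \<in> Obj C. \<forall>Y \<in> Obj C. bij_betw (farr F) (hom C X Y) (hom D (fobj F X) (fobj F Y)))"

definition id_fctr :: "('o, 'a, 'o, 'a) fctr" where
  "id_fctr = \<lparr>fobj = id, farr = id\<rparr>"

definition comp_fctr ::
    "('p, 'b, 'q, 'c) fctr \<Rightarrow> ('o, 'a, 'p, 'b) fctr \<Rightarrow> ('o, 'a, 'q, 'c) fctr" where
  "comp_fctr G F = \<lparr>fobj = fobj G \<circ> fobj F, farr = farr G \<circ> farr F\<rparr>"

definition prod_fctr ::
    "('o, 'a, 'p, 'b) fctr \<Rightarrow> ('o', 'a', 'p', 'b') fctr \<Rightarrow> ('o \<times> 'o', 'a \<times> 'a', 'p \<times> 'p', 'b \<times> 'b') fctr" where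
  "prod_fctr F G = \<lparr>fobj = map_prod (fobj F) (fobj G), farr = map_prod (farr F) (farr G)\<rparr>"

definition natural_iso ::
    "('o, 'a, 'm) category_scheme \<Rightarrow> ('p, 'b, 'n) category_scheme \<Rightarrow>
     ('o, 'a, 'p, 'b) fctr \<Rightarrow> ('o, 'a, 'p, 'b) fctr \<Rightarrow> ('o \<Rightarrow> 'b) \<Rightarrow> bool" where
  "natural_iso C D F G \<eta> \<longleftrightarrow> is_functor C D F \<and> is_functor C D G \<and>
     (\<forall>X \<in> Obj C. is_iso D (fobj F X) (fobj G X) (\<eta> X)) \<and>
     (\<forall>X \<in> Obj C. \<forall>Y \<in> Obj C. \<forall>f \<in> hom C X Y.
        \<eta> Y \<cdot>\<^bsub>D\<^esub> farr F f = farr G f \<cdot>\<^bsub>D\<^esub> \<eta> X)"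


section \<open>Semi-monoidal and monoidal categories\<close>

record ('o, 'a) semi_monoidal = "('o, 'a) category" +
  tens :: "('o \<times> 'o, 'a \<times> 'a, 'o, 'a) fctr"

text \<open>
  The juxtaposition \<open>XY\<close> of objects is written \<open>X \<otimes> Y\<close>, that of arrows \<open>f \<odot> g\<close>.
  An object standing for its identity arrow is always made explicit, so \<open>fX\<close>
  becomes \<open>f \<odot> idt C X\<close>.
\<close>

definition tens_obj :: "('o, 'a, 'm) semi_monoidal_scheme \<Rightarrow> 'o \<Rightarrow> 'o \<Rightarrow> 'o"  (infixr "\<otimes>\<index>" 70)
  where "X \<otimes>\<^bsub>C\<^esub> Y = fobj (tens C) (X, Y)"

definition tens_arr :: "('o, 'a, 'm) semi_monoidal_scheme \<Rightarrow> 'a \<Rightarrow> 'a \<Rightarrow> 'a"  (infixr "\<odot>\<index>" 70)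
  where "f \<odot>\<^bsub>C\<^esub> g = farr (tens C) (f, g)"

locale semi_monoidal_category = category C
  for C :: "('o, 'a, 'm) semi_monoidal_scheme" (structure) +
  assumes tens_functor: "is_functor (prod_cat C C) C (tens C)"
    and tens_obj_assoc: "\<lbrakk>X \<in> Obj C; Y \<in> Obj C; Z \<in> Obj C\<rbrakk>
          \<Longrightarrow> (X \<otimes> Y) \<otimes> Z = X \<otimes> (Y \<otimes> Z)"
    and tens_arr_assoc: "\<lbrakk>f \<in> Arr C; g \<in> Arr C; h \<in> Arr C\<rbrakk>
          \<Longrightarrow> (f \<odot> g) \<odot> h = f \<odot> (g \<odot> h)"

definition left_tens :: "('o, 'a, 'm) semi_monoidal_scheme \<Rightarrow> 'o \<Rightarrow> ('o, 'a, 'o, 'a) fctr" where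
  "left_tens C I = \<lparr>fobj = (\<lambda>X. I \<otimes>\<^bsub>C\<^esub> X), farr = (\<lambda>f. idt C I \<odot>\<^bsub>C\<^esub> f)\<rparr>"

definition right_tens :: "('o, 'a, 'm) semi_monoidal_scheme \<Rightarrow> 'o \<Rightarrow> ('o, 'a, 'o, 'a) fctr" where
  "right_tens C I = \<lparr>fobj = (\<lambda>X. X \<otimes>\<^bsub>C\<^esub> I), farr = (\<lambda>f. f \<odot>\<^bsub>C\<^esub> idt C I)\<rparr>"

definition LR_unit ::
    "('o, 'a, 'm) semi_monoidal_scheme \<Rightarrow> 'o \<Rightarrow> ('o \<Rightarrow> 'a) \<Rightarrow> ('o \<Rightarrow> 'a) \<Rightarrow> bool" where
  "LR_unit C I lam rho \<longleftrightarrow> I \<in> Obj C \<and>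
     natural_iso C C (left_tens C I) id_fctr lam \<and>
     natural_iso C C (right_tens C I) id_fctr rho \<and>
     lam I = rho I \<and>
     (\<forall>X \<in> Obj C. \<forall>Y \<in> Obj C.
        lam (X \<otimes>\<^bsub>C\<^esub> Y) = lam X \<odot>\<^bsub>C\<^esub> idt C Y \<and>
        rho (X \<otimes>\<^bsub>C\<^esub> Y) = idt C X \<odot>\<^bsub>C\<^esub> rho Y \<and>
        idt C X \<odot>\<^bsub>C\<^esub> lam Y = rho X \<odot>\<^bsub>C\<^esub> idt C Y)"

definition cancellable :: "('o, 'a, 'm) semi_monoidal_scheme \<Rightarrow> 'o \<Rightarrow> bool" where
  "cancellable C I \<longleftrightarrow> I \<in> Obj C \<and>
     fully_faithful C C (left_tens C I) \<and> fully_faithful C C (right_tens C I)"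

definition Saavedra_unit :: "('o, 'a, 'm) semi_monoidal_scheme \<Rightarrow> 'o \<Rightarrow> 'a \<Rightarrow> bool" where
  "Saavedra_unit C I \<alpha> \<longleftrightarrow> cancellable C I \<and> is_iso C (I \<otimes>\<^bsub>C\<^esub> I) I \<alpha>"

definition units_correspond ::
    "('o, 'a, 'm) semi_monoidal_scheme \<Rightarrow> 'o \<Rightarrow> ('o \<Rightarrow> 'a) \<Rightarrow> ('o \<Rightarrow> 'a) \<Rightarrow> 'a \<Rightarrow> bool" where
  "units_correspond C I lam rho \<alpha> \<longleftrightarrow> \<alpha> = lam I \<and> \<alpha> = rho I \<and>
     (\<forall>X \<in> Obj C. idt C I \<odot>\<^bsub>C\<^esub> lam X = \<alpha> \<odot>\<^bsub>C\<^esub> idt C X \<and>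
                  rho X \<odot>\<^bsub>C\<^esub> idt C I = idt C X \<odot>\<^bsub>C\<^esub> \<alpha>)"

record ('o, 'a) monoidal = "('o, 'a) semi_monoidal" +
  unit :: 'o
  lunit :: "'o \<Rightarrow> 'a"
  runit :: "'o \<Rightarrow> 'a"
  munit :: 'a

text \<open>
  A monoidal category carries both structures on its unit. Either one determines the
  other through \<open>units_correspond\<close>, so bundling them restricts nothing.
\<close>

locale monoidal_category = semi_monoidal_category C
  for C :: "('o, 'a, 'm) monoidal_scheme" (structure) +
  assumes LR: "LR_unit C (unit C) (lunit C) (runit C)"
    and Saavedra: "Saavedra_unit C (unit C) (munit C)"
    and correspond: "units_correspond C (unit C) (lunit C) (runit C) (munit C)"


section \<open>Multiplicative functors and unit compatibilities\<close>

text \<open>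
  The family \<open>\<phi>\<close> is indexed by pairs of objects: it is a natural isomorphism between
  the functors \<open>(X, Y) \<mapsto> F(X)F(Y)\<close> and \<open>(X, Y) \<mapsto> F(XY)\<close> on the product category.
\<close>

definition strong_multiplicative ::
    "('o, 'a, 'm) semi_monoidal_scheme \<Rightarrow> ('p, 'b, 'n) semi_monoidal_scheme \<Rightarrow>
     ('o, 'a, 'p, 'b) fctr \<Rightarrow> ('o \<times> 'o \<Rightarrow> 'b) \<Rightarrow> bool" where
  "strong_multiplicative C D F \<phi> \<longleftrightarrow> is_functor C D F \<and>
     natural_iso (prod_cat C C) D
       (comp_fctr (tens D) (prod_fctr F F)) (comp_fctr F (tens C)) \<phi> \<and>
     (\<forall>X \<in> Obj C. \<forall>Y \<in> Obj C. \<forall>Z \<in> Obj C.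
        \<phi> (X \<otimes>\<^bsub>C\<^esub> Y, Z) \<cdot>\<^bsub>D\<^esub> (\<phi> (X, Y) \<odot>\<^bsub>D\<^esub> idt D (fobj F Z)) =
        \<phi> (X, Y \<otimes>\<^bsub>C\<^esub> Z) \<cdot>\<^bsub>D\<^esub> (idt D (fobj F X) \<odot>\<^bsub>D\<^esub> \<phi> (Y, Z)))"

definition LR_compatibility ::
    "('o, 'a, 'm) monoidal_scheme \<Rightarrow> ('p, 'b, 'n) monoidal_scheme \<Rightarrow>
     ('o, 'a, 'p, 'b) fctr \<Rightarrow> ('o \<times> 'o \<Rightarrow> 'b) \<Rightarrow> 'b \<Rightarrow> bool" where
  "LR_compatibility C D F \<phi> \<phi>0 \<longleftrightarrow> is_iso D (unit D) (fobj F (unit C)) \<phi>0 \<and>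
     (\<forall>X \<in> Obj C.
        lunit D (fobj F X) =
          farr F (lunit C X) \<cdot>\<^bsub>D\<^esub> \<phi> (unit C, X) \<cdot>\<^bsub>D\<^esub> (\<phi>0 \<odot>\<^bsub>D\<^esub> idt D (fobj F X)) \<and>
        runit D (fobj F X) =
          farr F (runit C X) \<cdot>\<^bsub>D\<^esub> \<phi> (X, unit C) \<cdot>\<^bsub>D\<^esub> (idt D (fobj F X) \<odot>\<^bsub>D\<^esub> \<phi>0))"

definition Saavedra_compatibility ::
    "('o, 'a, 'm) monoidal_scheme \<Rightarrow> ('p, 'b, 'n) monoidal_scheme \<Rightarrow>
     ('o, 'a, 'p, 'b) fctr \<Rightarrow> ('o \<times> 'o \<Rightarrow> 'b) \<Rightarrow> 'b \<Rightarrow> bool" where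
  "Saavedra_compatibility C D F \<phi> \<phi>0 \<longleftrightarrow> is_iso D (unit D) (fobj F (unit C)) \<phi>0 \<and>
     \<phi>0 \<cdot>\<^bsub>D\<^esub> munit D =
       farr F (munit C) \<cdot>\<^bsub>D\<^esub> \<phi> (unit C, unit C) \<cdot>\<^bsub>D\<^esub> (\<phi>0 \<odot>\<^bsub>D\<^esub> \<phi>0)"

end

theory Submission
  imports Defs
begin

text \<open>
  If \<open>\<phi>\<^sub>0\<close> is an LR-unit compatibility, precomposing its left condition at \<open>X = I\<close> with \<open>J\<phi>\<^sub>0\<close>
  and using naturality of \<open>\<lambda>\<^sup>J\<close> yields the semi-monoid condition. Conversely, put
  \<open>L = F(\<lambda>\<^sub>X) \<circ> \<phi>\<^bsub>I,X\<^esub> \<circ> (\<phi>\<^sub>0 F(X))\<close>. Since \<open>J\<lambda>\<^sup>J\<^bsub>F(X)\<^esub> = \<beta>F(X)\<close> and \<open>J\<close> is cancellable, it suffices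
  that \<open>JL = \<beta>F(X)\<close>. This may be checked after composing with the isomorphisms \<open>\<phi>\<^sub>0F(X)\<close> and
  \<open>\<phi>\<^bsub>I,X\<^esub>\<close>, and then it follows from naturality and associativity of \<open>\<phi>\<^sub>2\<close> and \<open>I\<lambda>\<^sub>X = \<alpha>X\<close>.
  The right-hand side is symmetric.
\<close>

section \<open>Arrows and composition in a category\<close>

lemma hom_iff: "f \<in> hom C X Y \<longleftrightarrow> f \<in> Arr C \<and> dom C f = X \<and> cod C f = Y"
  by (simp add: hom_def)

lemma functor_hom:
  assumes "is_functor C D F" "f \<in> hom C X Y" "X \<in> Obj C" "Y \<in> Obj C"
  shows "farr F f \<in> hom D (fobj F X) (fobj F Y)"
  using assms by (simp add: is_functor_def)

context category
begin

text \<open>The locale axioms are phrased with \<open>hom\<close>. Splitting it into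
  \<open>Arr\<close>, \<open>dom\<close> and \<open>cod\<close>, here and in the next lemmas, lets
  the simplifier decide composability by computing sources and targets.\<close>

lemma idt_arr [simp]:
  assumes "X \<in> Obj C"
  shows "idt C X \<in> Arr C" "dom C (idt C X) = X" "cod C (idt C X) = X"
  using idt_hom[OF assms] by (auto simp: hom_iff)

lemma comp_arr [simp]:
  assumes "f \<in> Arr C" "g \<in> Arr C" "cod C f = dom C g"
  shows "g \<cdot> f \<in> Arr C" "dom C (g \<cdot> f) = dom C f" "cod C (g \<cdot> f) = cod C g"
  using comp_hom[of f "dom C f" "dom C g" g "cod C g"] assms by (auto simp: hom_iff)

lemma comp_idt_arr [simp]:
  assumes "f \<in> Arr C" "dom C f = X"
  shows "f \<cdot> idt C X = f"
  using comp_idt[of f X "cod C f"] assms by (auto simp: hom_iff)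

lemma idt_comp_arr [simp]:
  assumes "f \<in> Arr C" "cod C f = Y"
  shows "idt C Y \<cdot> f = f"
  using idt_comp[of f "dom C f" Y] assms by (auto simp: hom_iff)

lemma comp_assoc_arr:
  assumes "f \<in> Arr C" "g \<in> Arr C" "h \<in> Arr C" "cod C f = dom C g" "cod C g = dom C h"
  shows "(h \<cdot> g) \<cdot> f = h \<cdot> (g \<cdot> f)"
  using comp_assoc[of f "dom C f" "dom C g" g "dom C h" h "cod C h"] assms
  by (auto simp: hom_iff)

text \<open>A left inverse of \<open>m\<close> undoes composition with \<open>m\<close>. Later
  \<open>m\<close> is a component of \<phi>, or the tensor of \<open>\<phi>0\<close> with an
  identity.\<close>

lemma iso_monic:
  assumes m: "is_iso C Y Z m"
    and f: "f \<in> hom C X Y" and g: "g \<in> hom C X Y"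
    and eq: "m \<cdot> f = m \<cdot> g"
  shows "f = g"
proof -
  obtain n where n: "n \<in> hom C Z Y" "n \<cdot> m = idt C Y"
    using m by (auto simp: is_iso_def)
  have m': "m \<in> hom C Y Z"
    using m by (simp add: is_iso_def)
  have "f = n \<cdot> (m \<cdot> f)"
    using n f m' by (metis comp_assoc idt_comp)
  also have "\<dots> = n \<cdot> (m \<cdot> g)"
    by (simp only: eq)
  also have "\<dots> = g"
    using n g m' by (metis comp_assoc idt_comp)
  finally show ?thesis .
qed

end

section \<open>The tensor as a functor: interchange, isomorphisms, cancellation\<close>

context semi_monoidal_category
begin

lemma tens_obj_closed [simp]:
  assumes "X \<in> Obj C" "Y \<in> Obj C"
  shows "X \<otimes> Y \<in> Obj C"
  using tens_functor assms by (auto simp: is_functor_def prod_cat_def tens_obj_def)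

lemma tens_arr [simp]:
  assumes "f \<in> Arr C" "g \<in> Arr C"
  shows "f \<odot> g \<in> Arr C" "dom C (f \<odot> g) = dom C f \<otimes> dom C g"
    "cod C (f \<odot> g) = cod C f \<otimes> cod C g"
proof -
  have "(f, g) \<in> hom (prod_cat C C) (dom C f, dom C g) (cod C f, cod C g)"
    using assms by (simp add: hom_iff prod_cat_def)
  then have "farr (tens C) (f, g) \<in> hom C (fobj (tens C) (dom C f, dom C g))
      (fobj (tens C) (cod C f, cod C g))"
    by (rule functor_hom[OF tens_functor])
      (use assms in \<open>simp_all add: prod_cat_def dom_obj cod_obj\<close>)
  then show "f \<odot> g \<in> Arr C" "dom C (f \<odot> g) = dom C f \<otimes> dom C g"
    "cod C (f \<odot> g) = cod C f \<otimes> cod C g"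
    by (auto simp: hom_iff tens_arr_def tens_obj_def)
qed

lemma tens_idt:
  assumes "X \<in> Obj C" "Y \<in> Obj C"
  shows "idt C X \<odot> idt C Y = idt C (X \<otimes> Y)"
  using tens_functor assms
  by (auto simp: is_functor_def prod_cat_def tens_arr_def tens_obj_def)

text \<open>Composition in the product category is componentwise, so this is preservation of
  composites by the tensor functor.\<close>

lemma interchange:
  assumes "f \<in> Arr C" "f' \<in> Arr C" "g \<in> Arr C" "g' \<in> Arr C"
    and "cod C f = dom C f'" "cod C g = dom C g'"
  shows "(f' \<odot> g') \<cdot> (f \<odot> g) = (f' \<cdot> f) \<odot> (g' \<cdot> g)"
  using tens_functor assms
  by (auto simp: is_functor_def prod_cat_def tens_arr_def)

text \<open>The tensor of the two inverses is an inverse. This makes \<open>\<phi>0\<close> tensored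
  with an identity cancellable from the left.\<close>

lemma tens_iso:
  assumes "is_iso C X Y f" "is_iso C X' Y' f'"
  shows "is_iso C (X \<otimes> X') (Y \<otimes> Y') (f \<odot> f')"
proof -
  obtain g g' where g: "g \<in> hom C Y X" "g \<cdot> f = idt C X" "f \<cdot> g = idt C Y"
    and g': "g' \<in> hom C Y' X'" "g' \<cdot> f' = idt C X'" "f' \<cdot> g' = idt C Y'"
    using assms by (auto simp: is_iso_def)
  have f: "f \<in> hom C X Y" "f' \<in> hom C X' Y'"
    using assms by (auto simp: is_iso_def)
  have obj: "X \<in> Obj C" "Y \<in> Obj C" "X' \<in> Obj C" "Y' \<in> Obj C"
    using f dom_obj cod_obj by (auto simp: hom_iff)
  show ?thesis
    unfolding is_iso_def
  proof (intro conjI bexI)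
    show "(g \<odot> g') \<cdot> (f \<odot> f') = idt C (X \<otimes> X')"
      using f g g' obj by (simp add: hom_iff interchange tens_idt)
    show "(f \<odot> f') \<cdot> (g \<odot> g') = idt C (Y \<otimes> Y')"
      using f g g' obj by (simp add: hom_iff interchange tens_idt)
  qed (use f g g' in \<open>auto simp: hom_iff\<close>)
qed

lemma idt_iso:
  assumes "X \<in> Obj C"
  shows "is_iso C X X (idt C X)"
  using assms by (auto simp: is_iso_def hom_iff)

text \<open>Faithfulness of tensoring with \<open>I\<close> on the left, read as injectivity on a
  single hom-set.\<close>

lemma cancellable_left:
  assumes "cancellable C I" "f \<in> hom C X Y" "g \<in> hom C X Y" "idt C I \<odot> f = idt C I \<odot> g"
  shows "f = g"
proof -
  have "X \<in> Obj C" "Y \<in> Obj C"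
    using assms(2) dom_obj cod_obj by (auto simp: hom_iff)
  then have "inj_on (\<lambda>f. idt C I \<odot> f) (hom C X Y)"
    using assms(1) by (auto simp: cancellable_def fully_faithful_def left_tens_def bij_betw_def)
  then show ?thesis
    using assms by (auto dest: inj_onD)
qed

lemma cancellable_right:
  assumes "cancellable C I" "f \<in> hom C X Y" "g \<in> hom C X Y" "f \<odot> idt C I = g \<odot> idt C I"
  shows "f = g"
proof -
  have "X \<in> Obj C" "Y \<in> Obj C"
    using assms(2) dom_obj cod_obj by (auto simp: hom_iff)
  then have "inj_on (\<lambda>f. f \<odot> idt C I) (hom C X Y)"
    using assms(1) by (auto simp: cancellable_def fully_faithful_def right_tens_def bij_betw_def)
  then show ?thesis
    using assms by (auto dest: inj_onD)
qed

end

section \<open>The two unit structures and their correspondence\<close>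

context monoidal_category
begin

lemma unit_obj [simp]: "unit C \<in> Obj C"
  using LR by (simp add: LR_unit_def)

lemma lunit_arr [simp]:
  assumes "X \<in> Obj C"
  shows "lunit C X \<in> Arr C" "dom C (lunit C X) = unit C \<otimes> X" "cod C (lunit C X) = X"
  using LR assms
  by (auto simp: LR_unit_def natural_iso_def is_iso_def left_tens_def id_fctr_def hom_iff)

lemma runit_arr [simp]:
  assumes "X \<in> Obj C"
  shows "runit C X \<in> Arr C" "dom C (runit C X) = X \<otimes> unit C" "cod C (runit C X) = X"
  using LR assms
  by (auto simp: LR_unit_def natural_iso_def is_iso_def right_tens_def id_fctr_def hom_iff)

lemma lunit_natural:
  assumes "f \<in> hom C X Y"
  shows "lunit C Y \<cdot> (idt C (unit C) \<odot> f) = f \<cdot> lunit C X"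
proof -
  have "X \<in> Obj C" "Y \<in> Obj C"
    using assms dom_obj cod_obj by (auto simp: hom_iff)
  then show ?thesis
    using LR assms by (auto simp: LR_unit_def natural_iso_def left_tens_def id_fctr_def)
qed

lemma munit_arr [simp]:
  "munit C \<in> Arr C" "dom C (munit C) = unit C \<otimes> unit C" "cod C (munit C) = unit C"
  using Saavedra by (auto simp: Saavedra_unit_def is_iso_def hom_iff)

lemma munit_eq: "munit C = lunit C (unit C)"
  using correspond by (simp add: units_correspond_def)

text \<open>As the unit is cancellable, this equation determines \<open>lunit C X\<close> from
  \<open>munit C\<close>; applied in the target category, it turns a statement about the Saavedra
  unit into one about the left unit.\<close>

lemma unit_lunit:
  "X \<in> Obj C \<Longrightarrow> idt C (unit C) \<odot> lunit C X = munit C \<odot> idt C X"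
  using correspond by (simp add: units_correspond_def)

lemma runit_unit:
  "X \<in> Obj C \<Longrightarrow> runit C X \<odot> idt C (unit C) = idt C X \<odot> munit C"
  using correspond by (simp add: units_correspond_def)

lemma unit_cancellable: "cancellable C (unit C)"
  using Saavedra by (simp add: Saavedra_unit_def)

end

section \<open>Strong multiplicative functors with an invertible unit map\<close>

locale multiplicative_functor =
  C: monoidal_category C + D: monoidal_category D
  for C :: "('o, 'a, 'm) monoidal_scheme" and D :: "('p, 'b, 'n) monoidal_scheme" +
  fixes F :: "('o, 'a, 'p, 'b) fctr" and \<phi> :: "'o \<times> 'o \<Rightarrow> 'b" and \<phi>0 :: 'b
  assumes strong: "strong_multiplicative C D F \<phi>"
    and iso: "is_iso D (unit D) (fobj F (unit C)) \<phi>0"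
begin

lemma fobj_closed [simp]: "X \<in> Obj C \<Longrightarrow> fobj F X \<in> Obj D"
  using strong by (simp add: strong_multiplicative_def is_functor_def)

lemma farr_arr [simp]:
  assumes "f \<in> Arr C"
  shows "farr F f \<in> Arr D" "dom D (farr F f) = fobj F (dom C f)"
    "cod D (farr F f) = fobj F (cod C f)"
proof -
  have "f \<in> hom C (dom C f) (cod C f)"
    using assms by (simp add: hom_iff)
  then have "farr F f \<in> hom D (fobj F (dom C f)) (fobj F (cod C f))"
    using strong C.dom_obj[OF assms] C.cod_obj[OF assms]
    by (auto simp: strong_multiplicative_def intro: functor_hom)
  then show "farr F f \<in> Arr D" "dom D (farr F f) = fobj F (dom C f)"
    "cod D (farr F f) = fobj F (cod C f)"
    by (simp_all add: hom_iff)
qed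

lemma farr_idt: "X \<in> Obj C \<Longrightarrow> farr F (idt C X) = idt D (fobj F X)"
  using strong by (simp add: strong_multiplicative_def is_functor_def)

lemma \<phi>_iso:
  assumes "X \<in> Obj C" "Y \<in> Obj C"
  shows "is_iso D (fobj F X \<otimes>\<^bsub>D\<^esub> fobj F Y) (fobj F (X \<otimes>\<^bsub>C\<^esub> Y)) (\<phi> (X, Y))"
  using strong assms
  by (auto simp: strong_multiplicative_def natural_iso_def comp_fctr_def prod_fctr_def
      prod_cat_def tens_obj_def)

lemma \<phi>_arr [simp]:
  assumes "X \<in> Obj C" "Y \<in> Obj C"
  shows "\<phi> (X, Y) \<in> Arr D" "dom D (\<phi> (X, Y)) = fobj F X \<otimes>\<^bsub>D\<^esub> fobj F Y"
    "cod D (\<phi> (X, Y)) = fobj F (X \<otimes>\<^bsub>C\<^esub> Y)"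
  using \<phi>_iso[OF assms] by (auto simp: is_iso_def hom_iff)

text \<open>A pair \<open>(f, g)\<close> is one arrow of the product category, so two-variable
  naturality is ordinary naturality there, with the composite functors unfolded.\<close>

lemma \<phi>_natural:
  assumes "f \<in> hom C X X'" "g \<in> hom C Y Y'"
  shows "\<phi> (X', Y') \<cdot>\<^bsub>D\<^esub> (farr F f \<odot>\<^bsub>D\<^esub> farr F g) = farr F (f \<odot>\<^bsub>C\<^esub> g) \<cdot>\<^bsub>D\<^esub> \<phi> (X, Y)"
proof -
  have "X \<in> Obj C" "X' \<in> Obj C" "Y \<in> Obj C" "Y' \<in> Obj C"
    using assms C.dom_obj C.cod_obj by (auto simp: hom_iff)
  then have "(X, Y) \<in> Obj (prod_cat C C)" "(X', Y') \<in> Obj (prod_cat C C)"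
    "(f, g) \<in> hom (prod_cat C C) (X, Y) (X', Y')"
    using assms by (auto simp: prod_cat_def hom_iff)
  then have "\<phi> (X', Y') \<cdot>\<^bsub>D\<^esub> farr (comp_fctr (tens D) (prod_fctr F F)) (f, g) =
      farr (comp_fctr F (tens C)) (f, g) \<cdot>\<^bsub>D\<^esub> \<phi> (X, Y)"
    using strong unfolding strong_multiplicative_def natural_iso_def by blast
  then show ?thesis
    by (simp add: comp_fctr_def prod_fctr_def tens_arr_def)
qed

lemma \<phi>_assoc:
  assumes "X \<in> Obj C" "Y \<in> Obj C" "Z \<in> Obj C"
  shows "\<phi> (X \<otimes>\<^bsub>C\<^esub> Y, Z) \<cdot>\<^bsub>D\<^esub> (\<phi> (X, Y) \<odot>\<^bsub>D\<^esub> idt D (fobj F Z)) =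
    \<phi> (X, Y \<otimes>\<^bsub>C\<^esub> Z) \<cdot>\<^bsub>D\<^esub> (idt D (fobj F X) \<odot>\<^bsub>D\<^esub> \<phi> (Y, Z))"
  using strong assms by (simp add: strong_multiplicative_def)

lemma \<phi>0_arr [simp]:
  "\<phi>0 \<in> Arr D" "dom D \<phi>0 = unit D" "cod D \<phi>0 = fobj F (unit C)"
  using iso by (auto simp: is_iso_def hom_iff)

section \<open>Comparison of the two compatibility conditions\<close>

lemma LR_imp_Saavedra:
  assumes "LR_compatibility C D F \<phi> \<phi>0"
  shows "Saavedra_compatibility C D F \<phi> \<phi>0"
proof -
  let ?I = "unit C" and ?J = "unit D"
  let ?FI = "fobj F ?I"
  \<comment> \<open>Here \<open>munit D\<close> is the component of \<open>lunit D\<close> at the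
    unit, so the square at \<open>\<phi>0\<close> applies.\<close>
  have "\<phi>0 \<cdot>\<^bsub>D\<^esub> munit D = lunit D ?FI \<cdot>\<^bsub>D\<^esub> (idt D ?J \<odot>\<^bsub>D\<^esub> \<phi>0)"
    using D.lunit_natural[of \<phi>0 ?J ?FI] by (simp add: hom_iff D.munit_eq)
  also have "\<dots> = (farr F (munit C) \<cdot>\<^bsub>D\<^esub> \<phi> (?I, ?I) \<cdot>\<^bsub>D\<^esub> (\<phi>0 \<odot>\<^bsub>D\<^esub> idt D ?FI)) \<cdot>\<^bsub>D\<^esub>
      (idt D ?J \<odot>\<^bsub>D\<^esub> \<phi>0)"
    using assms by (simp add: LR_compatibility_def C.munit_eq)
  \<comment> \<open>By interchange the last two factors, each \<open>\<phi>0\<close> in one slot and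
    an identity in the other, merge into \<open>\<phi>0\<close> tensored with itself.\<close>
  also have "\<dots> = farr F (munit C) \<cdot>\<^bsub>D\<^esub> \<phi> (?I, ?I) \<cdot>\<^bsub>D\<^esub> (\<phi>0 \<odot>\<^bsub>D\<^esub> \<phi>0)"
    by (simp add: D.comp_assoc_arr D.interchange)
  finally show ?thesis
    using iso by (simp add: Saavedra_compatibility_def)
qed

text \<open>This is I\<lambda> = \<alpha>X carried through F. After composing with
  \<open>\<phi> (unit C, X)\<close>, each side becomes the image of one side of that equation,
  preceded by one of the two equal ways of multiplying F(I), F(I) and F(X).\<close>

lemma lunit_coherence:
  assumes X: "X \<in> Obj C"
  shows "idt D (fobj F (unit C)) \<odot>\<^bsub>D\<^esub> (farr F (lunit C X) \<cdot>\<^bsub>D\<^esub> \<phi> (unit C, X)) =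
    (farr F (munit C) \<cdot>\<^bsub>D\<^esub> \<phi> (unit C, unit C)) \<odot>\<^bsub>D\<^esub> idt D (fobj F X)"
proof (rule D.iso_monic[OF \<phi>_iso[OF C.unit_obj X]])
  let ?I = "unit C" and ?FI = "fobj F (unit C)" and ?FX = "fobj F X"
  have "\<phi> (?I, X) \<cdot>\<^bsub>D\<^esub> (idt D ?FI \<odot>\<^bsub>D\<^esub> (farr F (lunit C X) \<cdot>\<^bsub>D\<^esub> \<phi> (?I, X))) =
      \<phi> (?I, X) \<cdot>\<^bsub>D\<^esub> (idt D ?FI \<odot>\<^bsub>D\<^esub> farr F (lunit C X)) \<cdot>\<^bsub>D\<^esub> (idt D ?FI \<odot>\<^bsub>D\<^esub> \<phi> (?I, X))"
    using X by (simp add: D.interchange)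
  \<comment> \<open>The identity of F(I) is rewritten as the image of an identity, so that
    naturality applies to a pair of arrows of the source category.\<close>
  also have "\<dots> = (\<phi> (?I, X) \<cdot>\<^bsub>D\<^esub> (farr F (idt C ?I) \<odot>\<^bsub>D\<^esub> farr F (lunit C X))) \<cdot>\<^bsub>D\<^esub>
      (idt D ?FI \<odot>\<^bsub>D\<^esub> \<phi> (?I, X))"
    using X by (simp add: D.comp_assoc_arr farr_idt)
  \<comment> \<open>The source objects occur only on the right-hand side of
    \<open>\<phi>_natural\<close>, hence the explicit instantiation.\<close>
  also have "\<dots> = farr F (idt C ?I \<odot>\<^bsub>C\<^esub> lunit C X) \<cdot>\<^bsub>D\<^esub>
      \<phi> (?I, ?I \<otimes>\<^bsub>C\<^esub> X) \<cdot>\<^bsub>D\<^esub> (idt D ?FI \<odot>\<^bsub>D\<^esub> \<phi> (?I, X))"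
    using X by (simp add: \<phi>_natural[of _ ?I _ _ "?I \<otimes>\<^bsub>C\<^esub> X"] hom_iff D.comp_assoc_arr)
  \<comment> \<open>Two changes at once: the unit equation under F, and associativity of \<phi>
    regrouping the three factors.\<close>
  also have "\<dots> = farr F (munit C \<odot>\<^bsub>C\<^esub> idt C X) \<cdot>\<^bsub>D\<^esub>
      \<phi> (?I \<otimes>\<^bsub>C\<^esub> ?I, X) \<cdot>\<^bsub>D\<^esub> (\<phi> (?I, ?I) \<odot>\<^bsub>D\<^esub> idt D ?FX)"
    using X by (simp add: C.unit_lunit \<phi>_assoc)
  \<comment> \<open>Naturality again, now backwards, at \<open>munit C\<close> and the identity of
    \<open>X\<close>.\<close>
  also have "\<dots> = (\<phi> (?I, X) \<cdot>\<^bsub>D\<^esub> (farr F (munit C) \<odot>\<^bsub>D\<^esub> farr F (idt C X))) \<cdot>\<^bsub>D\<^esub>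
      (\<phi> (?I, ?I) \<odot>\<^bsub>D\<^esub> idt D ?FX)"
    using X
    by (simp add: \<phi>_natural[of _ "?I \<otimes>\<^bsub>C\<^esub> ?I" _ _ X] hom_iff D.comp_assoc_arr C.tens_obj_assoc)
  also have "\<dots> = \<phi> (?I, X) \<cdot>\<^bsub>D\<^esub> ((farr F (munit C) \<cdot>\<^bsub>D\<^esub> \<phi> (?I, ?I)) \<odot>\<^bsub>D\<^esub> idt D ?FX)"
    using X by (simp add: D.comp_assoc_arr D.interchange farr_idt)
  finally show "\<phi> (?I, X) \<cdot>\<^bsub>D\<^esub> (idt D ?FI \<odot>\<^bsub>D\<^esub> (farr F (lunit C X) \<cdot>\<^bsub>D\<^esub> \<phi> (?I, X))) =
      \<phi> (?I, X) \<cdot>\<^bsub>D\<^esub> ((farr F (munit C) \<cdot>\<^bsub>D\<^esub> \<phi> (?I, ?I)) \<odot>\<^bsub>D\<^esub> idt D ?FX)" .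
\<comment> \<open>The two arrows have sources bracketed differently; strict associativity on objects
  puts them in one hom-set.\<close>
qed (use X in \<open>auto simp: hom_iff D.tens_obj_assoc\<close>)

text \<open>Mirror image of \<open>lunit_coherence\<close>: the equation \<rho>I = X\<alpha> is
  carried through F, and associativity of \<phi> regroups in the opposite direction.\<close>

lemma runit_coherence:
  assumes X: "X \<in> Obj C"
  shows "(farr F (runit C X) \<cdot>\<^bsub>D\<^esub> \<phi> (X, unit C)) \<odot>\<^bsub>D\<^esub> idt D (fobj F (unit C)) =
    idt D (fobj F X) \<odot>\<^bsub>D\<^esub> (farr F (munit C) \<cdot>\<^bsub>D\<^esub> \<phi> (unit C, unit C))"
proof (rule D.iso_monic[OF \<phi>_iso[OF X C.unit_obj]])
  let ?I = "unit C" and ?FI = "fobj F (unit C)" and ?FX = "fobj F X"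
  have "\<phi> (X, ?I) \<cdot>\<^bsub>D\<^esub> ((farr F (runit C X) \<cdot>\<^bsub>D\<^esub> \<phi> (X, ?I)) \<odot>\<^bsub>D\<^esub> idt D ?FI) =
      \<phi> (X, ?I) \<cdot>\<^bsub>D\<^esub> (farr F (runit C X) \<odot>\<^bsub>D\<^esub> idt D ?FI) \<cdot>\<^bsub>D\<^esub> (\<phi> (X, ?I) \<odot>\<^bsub>D\<^esub> idt D ?FI)"
    using X by (simp add: D.interchange)
  also have "\<dots> = (\<phi> (X, ?I) \<cdot>\<^bsub>D\<^esub> (farr F (runit C X) \<odot>\<^bsub>D\<^esub> farr F (idt C ?I))) \<cdot>\<^bsub>D\<^esub>
      (\<phi> (X, ?I) \<odot>\<^bsub>D\<^esub> idt D ?FI)"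
    using X by (simp add: D.comp_assoc_arr farr_idt)
  also have "\<dots> = farr F (runit C X \<odot>\<^bsub>C\<^esub> idt C ?I) \<cdot>\<^bsub>D\<^esub>
      \<phi> (X \<otimes>\<^bsub>C\<^esub> ?I, ?I) \<cdot>\<^bsub>D\<^esub> (\<phi> (X, ?I) \<odot>\<^bsub>D\<^esub> idt D ?FI)"
    using X by (simp add: \<phi>_natural[of _ "X \<otimes>\<^bsub>C\<^esub> ?I" _ _ ?I] hom_iff D.comp_assoc_arr)
  also have "\<dots> = farr F (idt C X \<odot>\<^bsub>C\<^esub> munit C) \<cdot>\<^bsub>D\<^esub>
      \<phi> (X, ?I \<otimes>\<^bsub>C\<^esub> ?I) \<cdot>\<^bsub>D\<^esub> (idt D ?FX \<odot>\<^bsub>D\<^esub> \<phi> (?I, ?I))"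
    using X by (simp add: C.runit_unit \<phi>_assoc)
  also have "\<dots> = (\<phi> (X, ?I) \<cdot>\<^bsub>D\<^esub> (farr F (idt C X) \<odot>\<^bsub>D\<^esub> farr F (munit C))) \<cdot>\<^bsub>D\<^esub>
      (idt D ?FX \<odot>\<^bsub>D\<^esub> \<phi> (?I, ?I))"
    using X by (simp add: \<phi>_natural[of _ X _ _ "?I \<otimes>\<^bsub>C\<^esub> ?I"] hom_iff D.comp_assoc_arr)
  also have "\<dots> = \<phi> (X, ?I) \<cdot>\<^bsub>D\<^esub> (idt D ?FX \<odot>\<^bsub>D\<^esub> (farr F (munit C) \<cdot>\<^bsub>D\<^esub> \<phi> (?I, ?I)))"
    using X by (simp add: D.comp_assoc_arr D.interchange farr_idt)
  finally show "\<phi> (X, ?I) \<cdot>\<^bsub>D\<^esub> ((farr F (runit C X) \<cdot>\<^bsub>D\<^esub> \<phi> (X, ?I)) \<odot>\<^bsub>D\<^esub> idt D ?FI) =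
      \<phi> (X, ?I) \<cdot>\<^bsub>D\<^esub> (idt D ?FX \<odot>\<^bsub>D\<^esub> (farr F (munit C) \<cdot>\<^bsub>D\<^esub> \<phi> (?I, ?I)))" .
qed (use X in \<open>auto simp: hom_iff D.tens_obj_assoc\<close>)

lemma Saavedra_imp_lunit:
  assumes S: "Saavedra_compatibility C D F \<phi> \<phi>0" and X: "X \<in> Obj C"
  shows "lunit D (fobj F X) =
    farr F (lunit C X) \<cdot>\<^bsub>D\<^esub> \<phi> (unit C, X) \<cdot>\<^bsub>D\<^esub> (\<phi>0 \<odot>\<^bsub>D\<^esub> idt D (fobj F X))"
proof -
  let ?I = "unit C" and ?J = "unit D" and ?FI = "fobj F (unit C)" and ?FX = "fobj F X"
  let ?m = "farr F (munit C) \<cdot>\<^bsub>D\<^esub> \<phi> (?I, ?I)" and ?l = "farr F (lunit C X) \<cdot>\<^bsub>D\<^esub> \<phi> (?I, X)"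
  let ?L = "?l \<cdot>\<^bsub>D\<^esub> (\<phi>0 \<odot>\<^bsub>D\<^esub> idt D ?FX)"
  \<comment> \<open>Rebracketing isolates \<open>?m\<close>, the multiplication that F(I) inherits
    from \<alpha>.\<close>
  have S': "\<phi>0 \<cdot>\<^bsub>D\<^esub> munit D = ?m \<cdot>\<^bsub>D\<^esub> (\<phi>0 \<odot>\<^bsub>D\<^esub> \<phi>0)"
    using S by (simp add: Saavedra_compatibility_def D.comp_assoc_arr)
  have "idt D ?J \<odot>\<^bsub>D\<^esub> ?L = munit D \<odot>\<^bsub>D\<^esub> idt D ?FX"
  proof (rule D.iso_monic[OF D.tens_iso[OF iso D.idt_iso[OF fobj_closed[OF X]]]])
    \<comment> \<open>Interchange slides the outer \<open>\<phi>0\<close> past \<open>?L\<close>, so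
      that \<open>?l\<close> is tensored with the identity of F(I), as
      \<open>lunit_coherence\<close> requires.\<close>
    have "(\<phi>0 \<odot>\<^bsub>D\<^esub> idt D ?FX) \<cdot>\<^bsub>D\<^esub> (idt D ?J \<odot>\<^bsub>D\<^esub> ?L) =
        (idt D ?FI \<odot>\<^bsub>D\<^esub> ?l) \<cdot>\<^bsub>D\<^esub> (\<phi>0 \<odot>\<^bsub>D\<^esub> (\<phi>0 \<odot>\<^bsub>D\<^esub> idt D ?FX))"
      using X by (simp add: D.interchange)
    also have "\<dots> = (?m \<odot>\<^bsub>D\<^esub> idt D ?FX) \<cdot>\<^bsub>D\<^esub> ((\<phi>0 \<odot>\<^bsub>D\<^esub> \<phi>0) \<odot>\<^bsub>D\<^esub> idt D ?FX)"
      using X by (simp only: lunit_coherence) (simp add: D.tens_arr_assoc)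
    also have "\<dots> = (?m \<cdot>\<^bsub>D\<^esub> (\<phi>0 \<odot>\<^bsub>D\<^esub> \<phi>0)) \<odot>\<^bsub>D\<^esub> idt D ?FX"
      using X by (simp add: D.interchange)
    also have "\<dots> = (\<phi>0 \<cdot>\<^bsub>D\<^esub> munit D) \<odot>\<^bsub>D\<^esub> idt D ?FX"
      by (simp only: S')
    also have "\<dots> = (\<phi>0 \<odot>\<^bsub>D\<^esub> idt D ?FX) \<cdot>\<^bsub>D\<^esub> (munit D \<odot>\<^bsub>D\<^esub> idt D ?FX)"
      using X by (simp add: D.interchange)
    finally show "(\<phi>0 \<odot>\<^bsub>D\<^esub> idt D ?FX) \<cdot>\<^bsub>D\<^esub> (idt D ?J \<odot>\<^bsub>D\<^esub> ?L) =
        (\<phi>0 \<odot>\<^bsub>D\<^esub> idt D ?FX) \<cdot>\<^bsub>D\<^esub> (munit D \<odot>\<^bsub>D\<^esub> idt D ?FX)" .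
  qed (use X in \<open>auto simp: hom_iff D.tens_obj_assoc\<close>)
  \<comment> \<open>Both sides equal \<open>munit D\<close> tensored with the identity of
    F(X).\<close>
  then have "idt D ?J \<odot>\<^bsub>D\<^esub> lunit D ?FX = idt D ?J \<odot>\<^bsub>D\<^esub> ?L"
    using X by (simp add: D.unit_lunit)
  then have "lunit D ?FX = ?L"
    by (rule D.cancellable_left[OF D.unit_cancellable, rotated 2]) (use X in \<open>auto simp: hom_iff\<close>)
  then show ?thesis
    using X by (simp add: D.comp_assoc_arr)
qed

text \<open>Tensoring with J on the right turns \<open>runit D (fobj F X)\<close> into F(X)\<beta>.
  Right cancellability then reduces the claim to an equation checked after composing with F(X)
  tensored with \<open>\<phi>0\<close>.\<close>

lemma Saavedra_imp_runit:
  assumes S: "Saavedra_compatibility C D F \<phi> \<phi>0" and X: "X \<in> Obj C"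
  shows "runit D (fobj F X) =
    farr F (runit C X) \<cdot>\<^bsub>D\<^esub> \<phi> (X, unit C) \<cdot>\<^bsub>D\<^esub> (idt D (fobj F X) \<odot>\<^bsub>D\<^esub> \<phi>0)"
proof -
  let ?I = "unit C" and ?J = "unit D" and ?FI = "fobj F (unit C)" and ?FX = "fobj F X"
  let ?m = "farr F (munit C) \<cdot>\<^bsub>D\<^esub> \<phi> (?I, ?I)" and ?r = "farr F (runit C X) \<cdot>\<^bsub>D\<^esub> \<phi> (X, ?I)"
  let ?R = "?r \<cdot>\<^bsub>D\<^esub> (idt D ?FX \<odot>\<^bsub>D\<^esub> \<phi>0)"
  have S': "\<phi>0 \<cdot>\<^bsub>D\<^esub> munit D = ?m \<cdot>\<^bsub>D\<^esub> (\<phi>0 \<odot>\<^bsub>D\<^esub> \<phi>0)"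
    using S by (simp add: Saavedra_compatibility_def D.comp_assoc_arr)
  have "?R \<odot>\<^bsub>D\<^esub> idt D ?J = idt D ?FX \<odot>\<^bsub>D\<^esub> munit D"
  proof (rule D.iso_monic[OF D.tens_iso[OF D.idt_iso[OF fobj_closed[OF X]] iso]])
    have "(idt D ?FX \<odot>\<^bsub>D\<^esub> \<phi>0) \<cdot>\<^bsub>D\<^esub> (?R \<odot>\<^bsub>D\<^esub> idt D ?J) =
        (?r \<odot>\<^bsub>D\<^esub> idt D ?FI) \<cdot>\<^bsub>D\<^esub> ((idt D ?FX \<odot>\<^bsub>D\<^esub> \<phi>0) \<odot>\<^bsub>D\<^esub> \<phi>0)"
      using X by (simp add: D.interchange)
    \<comment> \<open>\<open>runit_coherence\<close> moves \<open>?r\<close> to \<open>?m\<close> in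
      the other slot; strict associativity on arrows regroups the right factor.\<close>
    also have "\<dots> = (idt D ?FX \<odot>\<^bsub>D\<^esub> ?m) \<cdot>\<^bsub>D\<^esub> (idt D ?FX \<odot>\<^bsub>D\<^esub> (\<phi>0 \<odot>\<^bsub>D\<^esub> \<phi>0))"
      using X by (simp only: runit_coherence) (simp add: D.tens_arr_assoc)
    also have "\<dots> = idt D ?FX \<odot>\<^bsub>D\<^esub> (?m \<cdot>\<^bsub>D\<^esub> (\<phi>0 \<odot>\<^bsub>D\<^esub> \<phi>0))"
      using X by (simp add: D.interchange)
    also have "\<dots> = idt D ?FX \<odot>\<^bsub>D\<^esub> (\<phi>0 \<cdot>\<^bsub>D\<^esub> munit D)"
      by (simp only: S')
    also have "\<dots> = (idt D ?FX \<odot>\<^bsub>D\<^esub> \<phi>0) \<cdot>\<^bsub>D\<^esub> (idt D ?FX \<odot>\<^bsub>D\<^esub> munit D)"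
      using X by (simp add: D.interchange)
    finally show "(idt D ?FX \<odot>\<^bsub>D\<^esub> \<phi>0) \<cdot>\<^bsub>D\<^esub> (?R \<odot>\<^bsub>D\<^esub> idt D ?J) =
        (idt D ?FX \<odot>\<^bsub>D\<^esub> \<phi>0) \<cdot>\<^bsub>D\<^esub> (idt D ?FX \<odot>\<^bsub>D\<^esub> munit D)" .
  qed (use X in \<open>auto simp: hom_iff D.tens_obj_assoc\<close>)
  then have "runit D ?FX \<odot>\<^bsub>D\<^esub> idt D ?J = ?R \<odot>\<^bsub>D\<^esub> idt D ?J"
    using X by (simp add: D.runit_unit)
  \<comment> \<open>The rotation puts the tensored equation first among the premises, where the
    chained fact is consumed.\<close>
  then have "runit D ?FX = ?R"
    by (rule D.cancellable_right[OF D.unit_cancellable, rotated 2]) (use X in \<open>auto simp: hom_iff\<close>)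
  then show ?thesis
    using X by (simp add: D.comp_assoc_arr)
qed

end

theorem proposition3p5:
  fixes C :: "('o, 'a) monoidal"
    and D :: "('p, 'b) monoidal"
    and F :: "('o, 'a, 'p, 'b) fctr"
    and \<phi> :: "'o \<times> 'o \<Rightarrow> 'b"
    and \<phi>0 :: 'b
  assumes "monoidal_category C"
    and "monoidal_category D"
    and "strong_multiplicative C D F \<phi>"
    and "is_iso D (unit D) (fobj F (unit C)) \<phi>0"
  shows "LR_compatibility C D F \<phi> \<phi>0 \<longleftrightarrow> Saavedra_compatibility C D F \<phi> \<phi>0"
proof -
  interpret multiplicative_functor C D F \<phi> \<phi>0
    using assms by (simp add: multiplicative_functor_def multiplicative_functor_axioms_def)
  show ?thesis
    using LR_imp_Saavedra Saavedra_imp_lunit Saavedra_imp_runit iso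
    by (auto simp: LR_compatibility_def)
qed

end
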